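(* Let $q$ be a prime power. If there exists an $\mathbf{F}_q$-linear $[[n,k,d]]_q$ MDS stabilizer code, then there exists a pure $\mathbf{F}_q$-linear $[[n,k-r,r,d]]_q$ MDS subsystem code for all $r$ in the range $0\le r\le k$.
   Context: Let $p$ be the characteristic of $\mathbf{F}_q$. For $(x|y)\in\mathbf{F}_q^{2n}$ (with $x,y\in\mathbf{F}_q^n$), $\mathrm{swt}(x|y)$ is the number of $i$ with $(x_i,y_i)\ne(0,0)$, and $\mathrm{swt}(S)$ is the minimum of $\mathrm{swt}$ over the nonzero elements of $S$. The trace-symplectic product of $(a|b)$ and $(a'|b')$ is $\mathrm{tr}_{q/p}(a'\cdot b-a\cdot b')$, and $C^{\perp_s}$ is the dual of $C\subseteq\mathbf{F}_q^{2n}$ with respect to it. All subsystem codes are Clifford subsystem codes: an $((n,K,R,d))_q$ subsystem code is a subspace $Q=A\otimes B$ of $\mathbf{C}^{q^n}$, $\dim A=K$, $\dim B=R$, arising from an additive code; concretely, its existence means that there is an additive subgroup $C\le\mathbf{F}_q^{2n}$ (the zero code is allowed) with $D=C\cap C^{\perp_s}$ such that $|C|=q^nR/K$, $|D|=q^n/(KR)$, and $d=\mathrm{swt}(D^{\perp_s}\setminus C)$ if $D^{\perp_s}\ne C$, while $d=\mathrm{swt}(D^{\perp_s})$ if $D^{\perp_s}=C$ (the case $K=1$). The subsystem code is $\mathbf{F}_q$-linear if $C$ is an $\mathbf{F}_q$-linear subspace of $\mathbf{F}_q^{2n}$. $[[n,k,r,d]]_q$ means $((n,q^k,q^r,d))_q$;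 an $[[n,k,d]]_q$ stabilizer code is the same as an $[[n,k,0,d]]_q$ subsystem code. The code derived from $C$ is pure to $d'$ if $C$ contains no nonzero element of symplectic weight less than $d'$; it is pure if it is pure to its minimum distance $d$. Every $\mathbf{F}_q$-linear $[[n,k,r,d]]_q$ subsystem code satisfies the Singleton bound $k+r\le n-2d+2$; it is called MDS if equality holds (for stabilizer codes, $r=0$). *)

theory Defs
  imports "HOL-Analysis.Analysis"
begin

(* A vector (x|y) of F_q^{2n} is an element of 'a ^ ('n + 'n), where q = CARD('a) and n = CARD('n):
   its x-part consists of the coordinates Inl i and its y-part of the coordinates Inr i. *)

definition swt :: "'a::zero ^ ('n::finite + 'n) \<Rightarrow> nat" where
  "swt v = card {i. (v $ Inl i, v $ Inr i) \<noteq> (0, 0)}"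

(* Meaningful only if S has a nonzero element; Min of the empty set is unspecified. *)
definition min_swt :: "('a::zero ^ ('n::finite + 'n)) set \<Rightarrow> nat" where
  "min_swt S = Min (swt ` (S - {0}))"

(* With q = p^m this is x + x^p + ... + x^(p^(m-1)).  The values lie in the prime subfield,
   which is not made a type of its own. *)
definition field_trace :: "'a::finite_field \<Rightarrow> 'a" where
  "field_trace x = (\<Sum>i < multiplicity CHAR('a) CARD('a). x ^ (CHAR('a) ^ i))"

(* tr(a' . b - a . b') for u = (a|b) and v = (a'|b') *)
definition trace_symplectic ::
    "'a::finite_field ^ ('n::finite + 'n) \<Rightarrow> 'a ^ ('n + 'n) \<Rightarrow> 'a" where
  "trace_symplectic u v =
     field_trace ((\<Sum>i\<in>UNIV. v $ Inl i * u $ Inr i) - (\<Sum>i\<in>UNIV. u $ Inl i * v $ Inr i))"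

definition symplectic_dual ::
    "('a::finite_field ^ ('n::finite + 'n)) set \<Rightarrow> ('a ^ ('n + 'n)) set" where
  "symplectic_dual C = {v. \<forall>u\<in>C. trace_symplectic u v = 0}"

definition additive_code :: "('a::ab_group_add ^ ('m::finite)) set \<Rightarrow> bool" where
  "additive_code C \<longleftrightarrow> 0 \<in> C \<and> (\<forall>u\<in>C. \<forall>v\<in>C. u + v \<in> C) \<and> (\<forall>u\<in>C. - u \<in> C)"

(* C gives rise to a Clifford subsystem code ((n,K,R,d))_q.  Since card D > 0, the third conjunct
   forces K and R to be positive, so no division by zero occurs. *)
definition subsystem_code ::
    "('a::finite_field ^ ('n::finite + 'n)) set \<Rightarrow> nat \<Rightarrow> nat \<Rightarrow> nat \<Rightarrow> bool" where
  "subsystem_code C K R d \<longleftrightarrow>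
     (let q = real CARD('a); n = CARD('n); D = C \<inter> symplectic_dual C in
        additive_code C \<and>
        real (card C) = q ^ n * real R / real K \<and>
        real (card D) = q ^ n / (real K * real R) \<and>
        d = (if symplectic_dual D \<noteq> C then min_swt (symplectic_dual D - C)
             else min_swt (symplectic_dual D)))"

(* The F_q-linear codes [[n,k,r,d]]_q *)
definition linear_subsystem_code ::
    "('a::finite_field ^ ('n::finite + 'n)) set \<Rightarrow> nat \<Rightarrow> nat \<Rightarrow> nat \<Rightarrow> bool" where
  "linear_subsystem_code C k r d \<longleftrightarrow>
     subsystem_code C (CARD('a) ^ k) (CARD('a) ^ r) d \<and> vec.subspace C"

(* Equality in the Singleton bound; over int, as n - 2d may be negative *)
definition MDS_subsystem_code ::
    "('a::finite_field ^ ('n::finite + 'n)) set \<Rightarrow> nat \<Rightarrow> nat \<Rightarrow> nat \<Rightarrow> bool" where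
  "MDS_subsystem_code C k r d \<longleftrightarrow>
     linear_subsystem_code C k r d \<and> int k + int r = int CARD('n) - 2 * int d + 2"

definition MDS_stabilizer_code ::
    "('a::finite_field ^ ('n::finite + 'n)) set \<Rightarrow> nat \<Rightarrow> nat \<Rightarrow> bool" where
  "MDS_stabilizer_code C k d \<longleftrightarrow> MDS_subsystem_code C k 0 d"

definition pure_to :: "('a::zero ^ ('n::finite + 'n)) set \<Rightarrow> nat \<Rightarrow> bool" where
  "pure_to C d' \<longleftrightarrow> \<not> (\<exists>c\<in>C. c \<noteq> 0 \<and> swt c < d')"

end

theory Submission
  imports Defs "HOL-Number_Theory.Residues"
begin

text \<open>
  Let \<open>C\<close> be the given stabilizer code, \<open>L\<close> its dual and \<open>m = d - 1\<close>, so that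
  \<open>dim C = 2 m\<close> and \<open>dim L = 2 (n - m)\<close>. If \<open>k > 0\<close>, then for sets \<open>S\<close> of \<open>m\<close> positions \<open>C\<close> and
  \<open>L\<close> have the same vectors supported on \<open>S\<close>, and duality shows that there are as many elements of \<open>C\<close>
  supported on \<open>S\<close> as on its complement. Hence an element of \<open>C\<close> supported on the complement of
  \<open>S\<close>, which has more than \<open>m\<close> elements, is supported on every \<open>m\<close>-subset of it and vanishes:
  \<open>C\<close> is pure, and \<open>L\<close> has minimum weight at least \<open>d\<close>.
  Adjoining \<open>r\<close> hyperbolic pairs from \<open>L\<close> to \<open>C\<close> yields a code \<open>E\<close> with radical \<open>C\<close>. Since \<open>L\<close> is
  spanned by its vectors of weight \<open>d\<close>, one of these lies outside \<open>E\<close> unless \<open>E = L\<close>, so the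
  distance is exactly \<open>d\<close>.
\<close>

section \<open>The trace form on linear codes\<close>

text \<open>The symplectic form before the trace is applied. It is bilinear over the whole field, so
  dimension counts are available; \<open>symplectic_dual_eq_sdual\<close> transfers them to the
  duals of linear codes.\<close>

definition sform :: "'a::field ^ ('n::finite + 'n) \<Rightarrow> 'a ^ ('n + 'n) \<Rightarrow> 'a" where
  "sform u v = (\<Sum>i\<in>UNIV. v $ Inl i * u $ Inr i) - (\<Sum>i\<in>UNIV. u $ Inl i * v $ Inr i)"

definition sdual :: "('a::field ^ ('n::finite + 'n)) set \<Rightarrow> ('a ^ ('n + 'n)) set" where
  "sdual W = {v. \<forall>u\<in>W. sform u v = 0}"

lemma sform_add_right: "sform u (v + v') = sform u v + sform u v'"
  by (simp add: sform_def algebra_simps sum.distrib)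

lemma sform_scale_left: "sform (c *s u) v = c * sform u v"
  by (simp add: sform_def algebra_simps sum_distrib_left)

lemma sform_scale_right: "sform u (c *s v) = c * sform u v"
  by (simp add: sform_def algebra_simps sum_distrib_left)

lemma sform_zero_right [simp]: "sform u 0 = 0"
  by (simp add: sform_def)

lemma sform_self [simp]: "sform u u = 0"
  by (simp add: sform_def mult.commute)

lemma sform_swap: "sform v u = - sform u v"
  by (simp add: sform_def mult.commute)

lemma sform_axis_Inl [simp]: "sform (axis (Inl i) 1) v = - v $ Inr i"
  by (simp add: sform_def axis_def if_distrib[of "\<lambda>x. x * _"] if_distrib[of "\<lambda>x. _ * x"] cong: if_cong)

lemma sform_axis_Inr [simp]: "sform (axis (Inr i) 1) v = v $ Inl i"
  by (simp add: sform_def axis_def if_distrib[of "\<lambda>x. x * _"] if_distrib[of "\<lambda>x. _ * x"] cong: if_cong)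

lemma field_trace_0 [simp]: "field_trace 0 = 0"
  by (simp add: field_trace_def power_0_left)

text \<open>The trace is a polynomial function of degree \<open>q / p\<close>, too small to vanish on all of the field.\<close>

lemma field_trace_nonzero: "\<exists>x::'a::finite_field. field_trace x \<noteq> 0"
proof (rule ccontr)
  assume "\<not> ?thesis"
  then have z: "field_trace x = 0" for x :: 'a by blast
  define p where "p = CHAR('a)"
  define m where "m = multiplicity p CARD('a)"
  have p: "prime p" by (simp add: p_def)
  have "p dvd CARD('a)" unfolding p_def by (rule CHAR_dvd_CARD)
  then have m: "m > 0" unfolding m_def using p
    by (simp add: prime_multiplicity_gt_zero_iff)
  have pm: "p ^ m \<le> CARD('a)"
    unfolding m_def by (intro dvd_imp_le multiplicity_dvd) simp
  define P :: "'a poly" where "P = (\<Sum>i<m. Polynomial.monom 1 (p ^ i))"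
  have inj: "p ^ i = p ^ j \<longleftrightarrow> i = j" for i j
    using prime_gt_1_nat[OF p] by simp
  \<comment> \<open>The exponents \<open>p ^ i\<close> are distinct, so only \<open>i = 0\<close>
    contributes to the coefficient of the linear term; \<open>m > 0\<close> ensures that this index
    occurs.\<close>
  have "poly.coeff P (p ^ 0) = (\<Sum>i<m. if i = 0 then 1 else 0)"
    unfolding P_def coeff_sum coeff_monom inj by (rule refl)
  also have "\<dots> = 1" using m by simp
  finally have P0: "P \<noteq> 0" by auto
  have "poly P x = 0" for x
    using z[of x] by (simp add: P_def poly_sum poly_monom field_trace_def m_def p_def)
  then have "CARD('a) \<le> degree P"
    using card_poly_roots_bound[OF P0] by simp
  moreover have "degree P \<le> p ^ (m - 1)"
    unfolding P_def
  proof (rule degree_sum_le)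
    fix i assume "i \<in> {..<m}"
    then have "p ^ i \<le> p ^ (m - 1)"
      using prime_gt_0_nat[OF p] by (intro power_increasing) auto
    then show "degree (Polynomial.monom (1::'a) (p ^ i)) \<le> p ^ (m - 1)"
      by (simp add: degree_monom_eq)
  qed simp
  moreover have "p ^ (m - 1) < p ^ m"
    using prime_gt_1_nat[OF p] m by simp
  ultimately show False using pm by linarith
qed

text \<open>If \<open>sform u v\<close> were nonzero, the multiples of \<open>u\<close>, all in
  \<open>W\<close>, would pair with \<open>v\<close> to every field element, in particular to one of
  nonzero trace.\<close>

lemma symplectic_dual_eq_sdual:
  assumes "vec.subspace W"
  shows "symplectic_dual W = sdual W"
proof
  show "sdual W \<subseteq> symplectic_dual W"
    by (auto simp: sdual_def symplectic_dual_def trace_symplectic_def simp flip: sform_def)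
  show "symplectic_dual W \<subseteq> sdual W"
  proof (clarsimp simp: sdual_def)
    fix v u assume v: "v \<in> symplectic_dual W" and u: "u \<in> W"
    show "sform u v = 0"
    proof (rule ccontr)
      assume nz: "sform u v \<noteq> 0"
      obtain x :: 'a where x: "field_trace x \<noteq> 0"
        using field_trace_nonzero by blast
      have "(x / sform u v) *s u \<in> W" using assms u by (rule vec.subspace_scale)
      then have "field_trace (sform ((x / sform u v) *s u) v) = 0"
        using v unfolding symplectic_dual_def trace_symplectic_def sform_def by auto
      then show False using nz x by (simp add: sform_scale_left)
    qed
  qed
qed

section \<open>Subspaces and symplectic duals\<close>

lemma card_subspace:
  fixes W :: "('a::finite_field ^ 'm::finite) set"
  assumes "vec.subspace W"
  shows "card W = CARD('a) ^ vec.dim W"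
proof -
  have *: "card (vec.span B) = CARD('a) ^ card B" if "finite B" "vec.independent B"
    for B :: "('a ^ 'm) set"
    using that
  proof (induction B rule: finite_induct)
    case empty
    then show ?case by (simp add: vec.span_empty)
  next
    case (insert b B)
    then have ind: "vec.independent B" and b: "b \<notin> vec.span B"
      by (auto simp: vec.independent_insert)
    \<comment> \<open>Each new basis vector multiplies the size of the span by
      \<open>CARD('a)\<close>.\<close>
    have "bij_betw (\<lambda>(c, x). c *s b + x) (UNIV \<times> vec.span B) (vec.span (insert b B))"
      unfolding bij_betw_def
    proof
      show "inj_on (\<lambda>(c, x). c *s b + x) (UNIV \<times> vec.span B)"
      proof (clarsimp simp: inj_on_def)
        fix c x c' x'
        assume x: "x \<in> vec.span B" "x' \<in> vec.span B" and eq: "c *s b + x = c' *s b + x'"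
        then have e: "(c - c') *s b = x' - x"
          by (simp add: vec.scale_left_diff_distrib algebra_simps)
        then have s: "(c - c') *s b \<in> vec.span B" using x by (simp add: vec.span_diff)
        have "c = c'"
        proof (rule ccontr)
          assume "c \<noteq> c'"
          then have "b = inverse (c - c') *s ((c - c') *s b)"
            by (simp only: vec.scale_scale) simp
          then show False using b s vec.span_scale by metis
        qed
        then show "c = c' \<and> x = x'" using eq by simp
      qed
      show "(\<lambda>(c, x). c *s b + x) ` (UNIV \<times> vec.span B) = vec.span (insert b B)"
      proof (intro equalityI subsetI)
        fix y assume "y \<in> vec.span (insert b B)"
        then obtain c where "y - c *s b \<in> vec.span B" unfolding vec.span_insert by blast
        then show "y \<in> (\<lambda>(c, x). c *s b + x) ` (UNIV \<times> vec.span B)"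
          by (intro image_eqI[of _ _ "(c, y - c *s b)"]) auto
      next
        fix y assume "y \<in> (\<lambda>(c, x). c *s b + x) ` (UNIV \<times> vec.span B)"
        then obtain c x where "y = c *s b + x" "x \<in> vec.span B" by auto
        then have "y - c *s b \<in> vec.span B" by simp
        then show "y \<in> vec.span (insert b B)" unfolding vec.span_insert by blast
      qed
    qed
    then have "card (vec.span (insert b B)) = card ((UNIV :: 'a set) \<times> vec.span B)"
      by (metis bij_betw_same_card)
    then show ?case using insert ind by (simp add: card_cartesian_product)
  qed
  obtain B where "B \<subseteq> W" "vec.independent B" "W \<subseteq> vec.span B" "card B = vec.dim W"
    using vec.basis_exists by blast
  with *[of B] show ?thesis
    using vec.span_subspace[OF _ _ assms] by (metis finite)
qed

lemma subspace_sdual: "vec.subspace (sdual W)"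
  by (auto simp: vec.subspace_def sdual_def sform_add_right sform_scale_right)

lemma sdual_antimono: "V \<subseteq> W \<Longrightarrow> sdual W \<subseteq> sdual V"
  by (auto simp: sdual_def)

lemma sdual_Un: "sdual (V \<union> W) = sdual V \<inter> sdual W"
  by (auto simp: sdual_def)

lemma subset_sdual_swap:
  fixes V W :: "('a::field ^ ('b::finite + 'b)) set"
  shows "V \<subseteq> sdual W \<longleftrightarrow> W \<subseteq> sdual V"
proof -
  have "sform u v = 0 \<longleftrightarrow> sform v u = 0" for u v :: "'a ^ ('b + 'b)"
    using sform_swap[of u v] by simp
  then show ?thesis unfolding sdual_def by blast
qed

text \<open>The double dual is a subspace containing \<open>W\<close>, hence it contains the span of
  \<open>W\<close>.\<close>

lemma sdual_span: "sdual (vec.span W) = sdual W"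
proof
  show "sdual (vec.span W) \<subseteq> sdual W"
    by (intro sdual_antimono vec.span_superset)
  have "W \<subseteq> sdual (sdual W)" using subset_sdual_swap by blast
  then have "vec.span W \<subseteq> sdual (sdual W)" by (intro vec.span_minimal subspace_sdual)
  then show "sdual W \<subseteq> sdual (vec.span W)" using subset_sdual_swap by blast
qed

lemma sdual_UNIV: "sdual (UNIV :: ('a::field ^ ('n::finite + 'n)) set) = {0}"
proof -
  have "v = 0" if v: "v \<in> sdual UNIV" for v :: "'a ^ ('n + 'n)"
  proof -
    have "v $ j = 0" for j
    proof (cases j)
      case (Inl i)
      have "sform (axis (Inr i) 1) v = 0" using v unfolding sdual_def by blast
      then show ?thesis using Inl by simp
    next
      case (Inr i)
      have "sform (axis (Inl i) 1) v = 0" using v unfolding sdual_def by blast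
      then show ?thesis using Inr by simp
    qed
    then show ?thesis by (simp add: vec_eq_iff)
  qed
  then show ?thesis by (auto simp: sdual_def)
qed

lemma dim_full: "vec.dim (UNIV :: ('a::field ^ ('n::finite + 'n)) set) = 2 * CARD('n)"
  using dim_substandard_cart[of "UNIV :: ('n + 'n) set", where 'a = 'a] by (simp add: card_Plus)

lemma dim_sdual_ge:
  fixes B :: "('a::field ^ ('n::finite + 'n)) set"
  assumes "finite B"
  shows "2 * CARD('n) \<le> vec.dim (sdual B) + card B"
  using assms
proof (induction B rule: finite_induct)
  case empty
  have "sdual {} = (UNIV :: ('a ^ ('n + 'n)) set)" by (simp add: sdual_def)
  then show ?case by (simp add: dim_full del: vec.dim_UNIV)
next
  case (insert b B)
  have "vec.dim (sdual B) \<le> vec.dim (sdual (insert b B)) + 1"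
  proof (cases "\<exists>v\<in>sdual B. sform b v \<noteq> 0")
    case True
    then obtain v where v: "v \<in> sdual B" "sform b v \<noteq> 0" by blast
    have "sdual B \<subseteq> vec.span (insert v (sdual (insert b B)))"
    proof
      fix x assume x: "x \<in> sdual B"
      \<comment> \<open>With this \<open>c\<close>, \<open>x - c *s v\<close> is orthogonal to
        \<open>b\<close>. So adjoining the single vector \<open>v\<close> to the smaller dual
        recovers \<open>sdual B\<close>.\<close>
      define c where "c = sform b x / sform b v"
      have "x - c *s v \<in> sdual B"
        using x v by (intro vec.subspace_diff vec.subspace_scale subspace_sdual)
      moreover have "sform b (x - c *s v) + sform b (c *s v) = sform b x"
        by (simp flip: sform_add_right)
      then have "sform b (x - c *s v) = 0" using v by (simp add: sform_scale_right c_def)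
      ultimately have "x - c *s v \<in> sdual (insert b B)" by (simp add: sdual_def)
      then show "x \<in> vec.span (insert v (sdual (insert b B)))"
        unfolding vec.span_insert using vec.span_base by blast
    qed
    then have "vec.dim (sdual B) \<le> vec.dim (insert v (sdual (insert b B)))"
      by (metis vec.dim_span vec.dim_subset)
    also have "\<dots> \<le> vec.dim (sdual (insert b B)) + 1" by (simp add: vec.dim_insert)
    finally show ?thesis .
  next
    case False
    then have "sdual B \<subseteq> sdual (insert b B)" by (auto simp: sdual_def)
    then show ?thesis by (meson trans_le_add1 vec.dim_subset)
  qed
  then show ?case using insert by simp
qed

lemma dim_inter_trivial_le:
  fixes U V W :: "('a::field ^ 'm::finite) set"
  assumes "vec.subspace U" "vec.subspace V" "vec.subspace W" "U \<subseteq> W" "V \<subseteq> W" "U \<inter> V \<subseteq> {0}"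
  shows "vec.dim U + vec.dim V \<le> vec.dim W"
proof -
  have "{x + y |x y. x \<in> U \<and> y \<in> V} \<subseteq> W"
    using assms vec.subspace_add by blast
  then have "vec.dim {x + y |x y. x \<in> U \<and> y \<in> V} \<le> vec.dim W" by (rule vec.dim_subset)
  moreover have "vec.dim (U \<inter> V) = 0"
    using assms(6) by (metis vec.dim_eq_0)
  ultimately show ?thesis using vec.dim_sums_Int[OF assms(1,2)] by linarith
qed

text \<open>Each generator lowers the dimension of the dual by at most one; a basis of the whole space
  lowers it from \<open>2 n\<close> to \<open>0\<close>, so every drop is exactly one.\<close>

lemma dim_sdual:
  fixes W :: "('a::field ^ ('n::finite + 'n)) set"
  assumes "vec.subspace W"
  shows "vec.dim (sdual W) + vec.dim W = 2 * CARD('n)"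
proof -
  obtain B where B: "B \<subseteq> W" "vec.independent B" "W \<subseteq> vec.span B" "card B = vec.dim W"
    using vec.basis_exists by blast
  have W: "vec.span B = W" using B assms by (intro vec.span_subspace)
  obtain E where E: "B \<subseteq> E" "vec.independent E" "UNIV \<subseteq> vec.span E"
    using vec.extend_basis_superset[OF B(2)] vec.independent_extend_basis[OF B(2)]
      vec.span_extend_basis[OF B(2)] by (metis order_refl)
  have fin: "finite E" using E(2) by (rule vec.finiteI_independent)
  have cE: "card E = 2 * CARD('n)"
    using vec.basis_card_eq_dim[OF subset_UNIV E(3,2)] dim_full by metis
  have "sdual B \<inter> sdual (E - B) = sdual (vec.span E)"
    using E(1) by (simp add: sdual_span Un_absorb1 flip: sdual_Un)
  also have "\<dots> = {0}" using E(3) sdual_UNIV by (metis top.extremum_uniqueI)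
  \<comment> \<open>The trivial intersection bounds the sum of the two dimensions by
    \<open>2 * CARD('n)\<close> from above. The lower bounds from \<open>dim_sdual_ge\<close> add up
    to the same number, so both are attained.\<close>
  finally have "vec.dim (sdual B) + vec.dim (sdual (E - B)) \<le> vec.dim (UNIV :: ('a ^ ('n + 'n)) set)"
    by (intro dim_inter_trivial_le subspace_sdual) auto
  then have "vec.dim (sdual B) + vec.dim (sdual (E - B)) \<le> 2 * CARD('n)" by (simp only: dim_full)
  moreover have "2 * CARD('n) \<le> vec.dim (sdual (E - B)) + card (E - B)"
    using fin by (intro dim_sdual_ge) auto
  moreover have "2 * CARD('n) \<le> vec.dim (sdual B) + card B"
    using fin E(1) by (intro dim_sdual_ge) (rule finite_subset)
  moreover have "card (E - B) = card E - card B" "card B \<le> card E"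
    using fin E(1) by (auto intro: card_Diff_subset finite_subset card_mono)
  moreover have "sdual B = sdual W" using W sdual_span by metis
  ultimately show ?thesis using cE B(4) by simp
qed

lemma sdual_sdual:
  fixes W :: "('a::field ^ ('n::finite + 'n)) set"
  assumes "vec.subspace W"
  shows "sdual (sdual W) = W"
proof -
  have "W \<subseteq> sdual (sdual W)" using subset_sdual_swap by blast
  moreover have "vec.dim (sdual (sdual W)) = vec.dim W"
    using dim_sdual[OF assms] dim_sdual[OF subspace_sdual, of W] by linarith
  ultimately show ?thesis
    using vec.subspace_dim_equal[OF assms subspace_sdual] by (metis order_refl)
qed

text \<open>Adjoining hyperbolic pairs from \<open>C\<^sup>\<bottom>\<close> to an isotropic \<open>C\<close> keeps the radical equal to \<open>C\<close>.\<close>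

lemma exists_extension_with_radical:
  fixes C :: "('a::field ^ ('n::finite + 'n)) set"
  assumes C: "vec.subspace C" "C \<subseteq> sdual C" and "vec.dim C + r \<le> CARD('n)"
  shows "\<exists>E. vec.subspace E \<and> E \<inter> sdual E = C \<and> vec.dim E = vec.dim C + 2 * r"
  using assms(3)
proof (induction r)
  case 0
  then show ?case using C by auto
next
  case (Suc r)
  then obtain E where E: "vec.subspace E" "E \<inter> sdual E = C" "vec.dim E = vec.dim C + 2 * r"
    by auto
  \<comment> \<open>The dual of \<open>E\<close> has dimension
    \<open>2 * CARD('n) - vec.dim C - 2 * r\<close>, at least \<open>vec.dim C + 2\<close>, so it is
    larger than the radical \<open>C\<close> of \<open>E\<close>.\<close>
  have "vec.dim (sdual E) > vec.dim C" using dim_sdual[OF E(1)] E(3) Suc.prems by linarith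
  then have "\<not> sdual E \<subseteq> C" using vec.dim_subset leD by blast
  then obtain u where u: "u \<in> sdual E" "u \<notin> E" using E(2) by blast
  \<comment> \<open>Since \<open>u\<close> is not in the double dual of \<open>E\<close>, some
    \<open>v\<close> in \<open>sdual E\<close> pairs nontrivially with it: a hyperbolic pair
    orthogonal to \<open>E\<close>.\<close>
  then have "u \<notin> sdual (sdual E)" using sdual_sdual[OF E(1)] by simp
  then obtain v where v: "v \<in> sdual E" "sform v u \<noteq> 0" by (auto simp: sdual_def)
  have uv: "sform u v \<noteq> 0" using v(2) sform_swap[of v u] by auto
  have eu: "sform e u = 0" "sform e v = 0" "sform u e = 0" "sform v e = 0" if "e \<in> E" for e
    using that u(1) v(1) sform_swap[of u e] sform_swap[of v e] by (auto simp: sdual_def)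
  have spE: "vec.span E = E" using E(1) by (simp add: vec.span_eq_iff)
  have mem: "\<exists>a b e. e \<in> E \<and> x = b *s v + (a *s u + e)" if x: "x \<in> vec.span (insert v (insert u E))" for x
  proof -
    from x obtain b where "x - b *s v \<in> vec.span (insert u E)"
      unfolding vec.span_insert[of v] by blast
    then obtain a where "x - b *s v - a *s u \<in> E"
      unfolding vec.span_insert[of u] spE by blast
    moreover have "x = b *s v + (a *s u + (x - b *s v - a *s u))" by simp
    ultimately show ?thesis by blast
  qed
  define F where "F = vec.span (insert v (insert u E))"
  have FE: "sdual F = sdual (insert v (insert u E))" by (simp add: F_def sdual_span)
  have "F \<inter> sdual F = C"
  proof
    show "F \<inter> sdual F \<subseteq> C"
    proof
      fix x assume x: "x \<in> F \<inter> sdual F"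
      then obtain a b e where e: "e \<in> E" and xe: "x = b *s v + (a *s u + e)"
        using mem F_def by blast
      have "sform u x = 0" "sform v x = 0" and xE: "x \<in> sdual E"
        using x unfolding FE by (auto simp: sdual_def)
      \<comment> \<open>Pairing \<open>x\<close> with \<open>u\<close> isolates the \<open>b\<close>
        term, pairing with \<open>v\<close> the \<open>a\<close> term.\<close>
      then have "b = 0" "a = 0"
        using uv v(2) eu[OF e] by (auto simp: xe sform_add_right sform_scale_right)
      then have "x = e" using xe by simp
      then show "x \<in> C" using xE e E(2) by blast
    qed
    show "C \<subseteq> F \<inter> sdual F"
    proof
      fix x assume "x \<in> C"
      then have x: "x \<in> E" "x \<in> sdual E" using E(2) by auto
      then show "x \<in> F \<inter> sdual F"
        using eu[OF x(1)] unfolding FE by (auto simp: F_def sdual_def intro: vec.span_base)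
    qed
  qed
  moreover have "v \<notin> vec.span (insert u E)"
  proof
    assume "v \<in> vec.span (insert u E)"
    then obtain a where "v - a *s u \<in> E" unfolding vec.span_insert[of u] spE by blast
    then have "sform u (v - a *s u) = 0" using eu by blast
    then have "sform u (v - a *s u) + sform u (a *s u) = 0" by (simp add: sform_scale_right)
    then show False using uv by (simp flip: sform_add_right)
  qed
  then have "vec.dim F = vec.dim E + 2"
    using u(2) unfolding F_def by (simp add: vec.dim_insert spE)
  ultimately show ?case
    using E(3) by (intro exI[of _ F]) (auto simp: F_def)
qed

section \<open>Vectors supported on a set of positions\<close>

text \<open>A weight bound is not a linear condition, but vanishing outside a fixed set of positions
  is; each position accounts for two coordinates.\<close>

definition supported :: "'n set \<Rightarrow> ('a::field ^ ('n::finite + 'n)) set" where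
  "supported S = {x. \<forall>i. i \<notin> S \<longrightarrow> x $ Inl i = 0 \<and> x $ Inr i = 0}"

lemma subspace_supported: "vec.subspace (supported S)"
  by (auto simp: vec.subspace_def supported_def)

lemma supported_mono: "S \<subseteq> T \<Longrightarrow> supported S \<subseteq> supported T"
  by (auto simp: supported_def)

lemma supported_Int: "supported S \<inter> supported T = supported (S \<inter> T)"
  by (auto simp: supported_def)

lemma swt_supported: "x \<in> supported S \<Longrightarrow> swt x \<le> card S"
  unfolding swt_def by (intro card_mono) (auto simp: supported_def)

lemma exists_support_swt: "\<exists>S. x \<in> supported S \<and> card S = swt x"
  by (intro exI[of _ "{i. (x $ Inl i, x $ Inr i) \<noteq> (0, 0)}"]) (auto simp: supported_def swt_def)

lemma dim_supported:
  fixes S :: "'n::finite set"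
  shows "vec.dim (supported S :: ('a::field ^ ('n + 'n)) set) = 2 * card S"
proof -
  have "supported S = {x :: 'a ^ ('n + 'n). \<forall>j. j \<notin> Inl ` S \<union> Inr ` S \<longrightarrow> x $ j = 0}"
    unfolding supported_def by (auto simp: split_sum_all)
  moreover have "card (Inl ` S \<union> Inr ` S :: ('n + 'n) set) = 2 * card S"
    by (subst card_Un_disjoint) (auto simp: card_image)
  ultimately show ?thesis
    using dim_substandard_cart[of "Inl ` S \<union> Inr ` S", where 'a = 'a] by simp
qed

lemma card_compl_add: "card (- S) + card S = CARD('n)" for S :: "'n::finite set"
  using card_Un_disjoint[of "- S" S] by (simp add: Compl_partition2)

lemma sdual_supported:
  fixes S :: "'n::finite set"
  shows "sdual (supported S) = (supported (- S) :: ('a::field ^ ('n + 'n)) set)"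
proof -
  have "supported (- S) \<subseteq> (sdual (supported S) :: ('a ^ ('n + 'n)) set)"
  proof
    fix x :: "'a ^ ('n + 'n)" assume x: "x \<in> supported (- S)"
    have "sform u x = 0" if u: "u \<in> supported S" for u
    proof -
      have "u $ Inl i * x $ Inr i = 0" "x $ Inl i * u $ Inr i = 0" for i
        using x u by (cases "i \<in> S"; simp add: supported_def)+
      then show ?thesis unfolding sform_def by (simp only: sum.neutral_const diff_self)
    qed
    then show "x \<in> sdual (supported S)" by (simp add: sdual_def)
  qed
  moreover have "vec.dim (sdual (supported S) :: ('a ^ ('n + 'n)) set)
      = vec.dim (supported (- S) :: ('a ^ ('n + 'n)) set)"
    using dim_sdual[OF subspace_supported[of S, where 'a = 'a]] card_compl_add[of S]
    by (simp add: dim_supported)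
  ultimately show ?thesis
    using vec.subspace_dim_equal[OF subspace_supported subspace_sdual] by (metis order_refl)
qed

text \<open>The left intersection is the dual of \<open>C + supported (- S)\<close>; the dimension
  formulas for duals and for sums give the identity.\<close>

lemma dim_sdual_Int_supported:
  fixes C :: "('a::field ^ ('n::finite + 'n)) set"
  assumes "vec.subspace C"
  shows "vec.dim (sdual C \<inter> supported S) + vec.dim C = 2 * card S + vec.dim (C \<inter> supported (- S))"
proof -
  let ?A = "{x + y |x y. x \<in> C \<and> y \<in> supported (- S)}"
  have A: "?A = vec.span (C \<union> supported (- S))"
    using vec.span_Un[of C "supported (- S)"] assms subspace_supported[of "- S", where 'a = 'a]
    by (simp add: vec.span_eq_iff[THEN iffD2])
  then have "sdual ?A = sdual C \<inter> supported S"
    by (simp add: sdual_span sdual_Un sdual_supported)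
  moreover have "vec.subspace ?A" using A by simp
  ultimately have "vec.dim (sdual C \<inter> supported S) + vec.dim ?A = 2 * CARD('n)"
    using dim_sdual[of ?A] by simp
  moreover have "vec.dim ?A + vec.dim (C \<inter> supported (- S)) = vec.dim C + 2 * card (- S)"
    using vec.dim_sums_Int[OF assms subspace_supported, of "- S"] by (simp add: dim_supported)
  ultimately show ?thesis using card_compl_add[of S] by linarith
qed


text \<open>Extends the weight bound from \<open>sdual C - C\<close> to \<open>C\<close>. The strict
  inequality \<open>2 * m < CARD('n)\<close> excludes a self-dual \<open>C\<close>, about which
  \<open>wt\<close> would say nothing.\<close>

lemma no_low_weight_if_isotropic:
  fixes C :: "('a::field ^ ('n::finite + 'n)) set"
  assumes C: "vec.subspace C" "C \<subseteq> sdual C" "vec.dim C = 2 * m" and "2 * m < CARD('n)"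
    and wt: "\<And>x. x \<in> sdual C - C \<Longrightarrow> m < swt x"
    and x: "x \<in> C" "swt x \<le> m"
  shows "x = 0"
proof -
  let ?f = "\<lambda>S. vec.dim (C \<inter> supported S)"
  have compl: "?f (- S) = ?f S" if "card S = m" for S
  proof -
    have "y \<in> C" if "y \<in> sdual C" "y \<in> supported S" for y
      using wt[of y] swt_supported[OF that(2)] that(1) \<open>card S = m\<close> by fastforce
    then have "sdual C \<inter> supported S = C \<inter> supported S" using C(2) by blast
    then show ?thesis using dim_sdual_Int_supported[OF C(1), of S] C(3) that by simp
  qed
  have mono: "?f S \<le> ?f T" if "S \<subseteq> T" for S T
    using supported_mono[OF that] by (intro vec.dim_subset) auto
  have sub: "vec.subspace (C \<inter> supported S)" for S
    using C(1) subspace_supported by (rule vec.subspace_inter)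
  have disj: "C \<inter> supported (- S) \<subseteq> supported T" if "card S = m" "card T = m" "T \<subseteq> - S" for S T
  proof -
    \<comment> \<open>Complementation turns \<open>S \<subseteq> - T\<close> into an inequality that
      is opposite to the one given by \<open>T \<subseteq> - S\<close>, so the nested spaces
      coincide.\<close>
    have "?f (- S) = ?f S" "?f S \<le> ?f (- T)" "?f (- T) = ?f T"
      using compl that mono[of S "- T"] by auto
    then have "C \<inter> supported T = C \<inter> supported (- S)"
      using supported_mono[OF that(3)] by (intro vec.subspace_dim_equal sub) auto
    then show ?thesis by blast
  qed
  obtain S0 where S0: "x \<in> supported S0" "card S0 = swt x" using exists_support_swt by blast
  obtain S where S: "S0 \<subseteq> S" "card S = m"
    using exists_subset_between[of S0 m UNIV] S0 x(2) assms(4) by auto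
  have "y = 0" if y: "y \<in> C \<inter> supported (- S)" for y
  proof -
    have "y $ Inl i = 0 \<and> y $ Inr i = 0" for i
    proof (cases "i \<in> S")
      case True
      then show ?thesis using y by (auto simp: supported_def)
    next
      case False
      \<comment> \<open>As \<open>- S\<close> has more than \<open>m\<close> elements, an
        \<open>m\<close>-subset of it can avoid \<open>i\<close>, which forces \<open>y\<close> to
        vanish at \<open>i\<close>.\<close>
      then have "m \<le> card (- S - {i})"
        using S(2) assms(4) card_compl_add[of S] by simp
      then obtain T where T: "T \<subseteq> - S - {i}" "card T = m"
        by (metis obtain_subset_with_card_n)
      then have "y \<in> supported T" using disj[OF S(2) T(2)] y by blast
      then show ?thesis using T by (auto simp: supported_def)
    qed
    then show ?thesis by (simp add: vec_eq_iff split_sum_all)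
  qed
  then have "C \<inter> supported (- S) \<subseteq> {0}" by blast
  then have "?f (- S) = 0" by (simp only: vec.dim_eq_0)
  then have "?f S = 0" using compl[OF S(2)] by simp
  then have "C \<inter> supported S \<subseteq> {0}" by (simp only: vec.dim_eq_0)
  moreover have "x \<in> supported S" using S0 supported_mono[OF S(1)] by blast
  ultimately show ?thesis using x(1) by blast
qed

text \<open>For \<open>card T = m\<close> and \<open>i \<notin> T\<close>, the vectors of \<open>L\<close> supported on \<open>T \<union> {i}\<close> form a space of
  dimension at least two, and as \<open>i\<close> varies these spaces are independent, so they span \<open>L\<close>.\<close>

lemma exists_minimum_weight:
  fixes L :: "('a::field ^ ('n::finite + 'n)) set"
  assumes L: "vec.subspace L" "vec.dim L + 2 * m = 2 * CARD('n)"
    and wt: "\<And>x. x \<in> L \<Longrightarrow> x \<noteq> 0 \<Longrightarrow> m < swt x"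
    and W: "vec.subspace W" "W \<subset> L"
  shows "\<exists>x\<in>L - W. swt x = Suc m"
proof (rule ccontr)
  assume neg: "\<not> ?thesis"
  have LW: "x \<in> W" if "x \<in> L" "swt x \<le> Suc m" for x
    using neg wt[of x] that vec.subspace_0[OF W(1)] by (cases "x = 0") (auto simp: le_Suc_eq)
  obtain T :: "'n set" where T: "card T = m"
    using obtain_subset_with_card_n[of m "UNIV :: 'n set"] L(2) by auto
  have LT: "L \<inter> supported T \<subseteq> {0}"
    using wt swt_supported T by fastforce
  have "2 * card J \<le> vec.dim (W \<inter> supported (T \<union> J))" if "J \<inter> T = {}" for J
    using finite[of J] that
  proof (induction J rule: finite_induct)
    case empty
    then show ?case by simp
  next
    case (insert i J)
    let ?A = "W \<inter> supported (T \<union> J)" and ?B = "L \<inter> supported (insert i T)"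
    have iT: "i \<notin> T" using insert by blast
    have "vec.dim {x + y |x y. x \<in> L \<and> y \<in> supported (insert i T)} \<le> 2 * CARD('n)"
      unfolding dim_full[where 'a = 'a, symmetric] by (rule vec.dim_subset[OF subset_UNIV])
    \<comment> \<open>The dimensions \<open>2 * (CARD('n) - m)\<close> and
      \<open>2 * (m + 1)\<close> exceed that of the whole space by 2.\<close>
    then have "2 \<le> vec.dim ?B"
      using vec.dim_sums_Int[OF L(1) subspace_supported[of "insert i T"]] L(2) T iT
      by (simp add: dim_supported)
    moreover have "vec.dim ?A + vec.dim ?B \<le> vec.dim (W \<inter> supported (T \<union> insert i J))"
    proof (rule dim_inter_trivial_le)
      have "swt x \<le> Suc m" if "x \<in> supported (insert i T)" for x :: "'a ^ ('n + 'n)"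
        using swt_supported[OF that] T iT by simp
      then have "?B \<subseteq> W" using LW by blast
      moreover have "?B \<subseteq> supported (T \<union> insert i J)"
        using supported_mono[of "insert i T" "T \<union> insert i J"] by blast
      ultimately show "?B \<subseteq> W \<inter> supported (T \<union> insert i J)" by blast
      show "?A \<subseteq> W \<inter> supported (T \<union> insert i J)"
        using supported_mono[of "T \<union> J" "T \<union> insert i J"] by blast
      \<comment> \<open>A common vector lies in \<open>L\<close> and is supported on the
        \<open>m\<close> positions of \<open>T\<close>, hence is zero.\<close>
      have "(T \<union> J) \<inter> insert i T = T" using insert by blast
      then have "?A \<inter> ?B \<subseteq> L \<inter> supported T"
        using supported_Int[of "T \<union> J" "insert i T", where 'a = 'a] by auto
      then show "?A \<inter> ?B \<subseteq> {0}" using LT by blast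
    qed (intro vec.subspace_inter L(1) W(1) subspace_supported)+
    ultimately show ?case using insert by simp
  qed
  from this[of "- T"] have "2 * card (- T) \<le> vec.dim (W \<inter> supported (T \<union> - T))" by simp
  also have "\<dots> \<le> vec.dim W" by (intro vec.dim_subset) blast
  finally have "vec.dim L \<le> vec.dim W" using L(2) T card_compl_add[of T] by linarith
  then show False
    using vec.subspace_dim_equal[OF W(1) L(1)] W(2) by blast
qed

section \<open>From MDS stabilizer codes to MDS subsystem codes\<close>

lemma min_swt_le: "x \<in> S \<Longrightarrow> x \<noteq> 0 \<Longrightarrow> min_swt S \<le> swt x"
  for x :: "'a::{zero,finite} ^ ('n::finite + 'n)"
  unfolding min_swt_def by (intro Min_le) auto

lemma min_swt_eqI:
  fixes x :: "'a::{zero,finite} ^ ('n::finite + 'n)"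
  assumes "x \<in> S" "x \<noteq> 0" "\<And>y. y \<in> S \<Longrightarrow> y \<noteq> 0 \<Longrightarrow> swt x \<le> swt y"
  shows "min_swt S = swt x"
  unfolding min_swt_def using assms by (intro Min_eqI) auto

lemma swt_pos: "x \<noteq> 0 \<Longrightarrow> 0 < swt x"
  for x :: "'a::zero ^ ('n::finite + 'n)"
  unfolding swt_def by (auto simp: card_gt_0_iff vec_eq_iff split_sum_ex)

text \<open>Taking logarithms to base \<open>CARD('a)\<close> turns the size conditions into
  conditions on dimensions, written additively to avoid truncated subtraction.\<close>

lemma linear_subsystem_code_iff:
  fixes C :: "('a::finite_field ^ ('n::finite + 'n)) set"
  shows "linear_subsystem_code C k r d \<longleftrightarrow>
    vec.subspace C \<and> vec.dim C + k = CARD('n) + r \<and> vec.dim (C \<inter> sdual C) + k + r = CARD('n) \<and>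
    d = (let D = C \<inter> sdual C in
          if sdual D \<noteq> C then min_swt (sdual D - C) else min_swt (sdual D))"
proof (cases "vec.subspace C")
  case True
  define D where "D = C \<inter> sdual C"
  have D: "vec.subspace D"
    unfolding D_def using True subspace_sdual by (rule vec.subspace_inter)
  have q: "CARD('a) > 1"
    using card_mono[of UNIV "{0 :: 'a, 1}"] by simp
  have add: "additive_code C"
    using True unfolding additive_code_def
    by (auto intro: vec.subspace_0 vec.subspace_add vec.subspace_neg)
  have pow: "real (CARD('a) ^ a) * real (CARD('a) ^ b) = real (CARD('a) ^ c) * real (CARD('a) ^ e)
      \<longleftrightarrow> a + b = c + e" for a b c e
    using q by (simp flip: power_add of_nat_mult of_nat_power)
  have "real (card C) = real CARD('a) ^ CARD('n) * real (CARD('a) ^ r) / real (CARD('a) ^ k)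
      \<longleftrightarrow> vec.dim C + k = CARD('n) + r"
    unfolding pow[symmetric] using q by (simp add: card_subspace[OF True] field_simps)
  moreover have "real (card D) = real CARD('a) ^ CARD('n) / (real (CARD('a) ^ k) * real (CARD('a) ^ r))
      \<longleftrightarrow> vec.dim D + (k + r) = CARD('n) + 0"
    unfolding pow[symmetric] using q by (simp add: card_subspace[OF D] field_simps power_add)
  ultimately show ?thesis
    unfolding linear_subsystem_code_def subsystem_code_def Let_def
      symplectic_dual_eq_sdual[OF True] D_def[symmetric] symplectic_dual_eq_sdual[OF D]
    using True add by (simp add: add.assoc)
qed (simp add: linear_subsystem_code_def)

theorem theorem18:
  fixes k d :: nat
  assumes "\<exists>C :: ('a::finite_field ^ ('n::finite + 'n)) set. MDS_stabilizer_code C k d"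
  shows "\<forall>r::nat. 0 \<le> r \<and> r \<le> k \<longrightarrow>
           (\<exists>C :: ('a ^ ('n + 'n)) set. MDS_subsystem_code C (k - r) r d \<and> pure_to C d)"
proof (intro allI impI)
  fix r :: nat assume "0 \<le> r \<and> r \<le> k"
  then have r: "r \<le> k" by simp
  obtain C :: "('a ^ ('n + 'n)) set" where "MDS_stabilizer_code C k d" using assms by blast
  then have lin: "linear_subsystem_code C k 0 d" and mds: "int k = int CARD('n) - 2 * int d + 2"
    by (auto simp: MDS_stabilizer_code_def MDS_subsystem_code_def)
  have C: "vec.subspace C" and dC: "vec.dim C + k = CARD('n)"
    using lin by (auto simp: linear_subsystem_code_iff)
  have "vec.dim (C \<inter> sdual C) = vec.dim C"
    using lin by (auto simp: linear_subsystem_code_iff)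
  then have CC: "C \<inter> sdual C = C"
    using vec.subspace_dim_equal[OF vec.subspace_inter[OF C subspace_sdual] C] by simp
  then have CL: "C \<subseteq> sdual C" by blast
  have d: "d = (if sdual C \<noteq> C then min_swt (sdual C - C) else min_swt (sdual C))"
    using lin by (simp add: linear_subsystem_code_iff CC)
  have dL: "vec.dim (sdual C) + vec.dim C = 2 * CARD('n)" by (rule dim_sdual[OF C])
  define m where "m = d - 1"
  have Lnz: "\<not> sdual C \<subseteq> {0}"
  proof
    assume "sdual C \<subseteq> {0}"
    then have "vec.dim (sdual C) = 0" by (simp only: vec.dim_eq_0)
    then show False using dL dC zero_less_card_finite[where 'a = 'n] by linarith
  qed
  \<comment> \<open>The minimum defining \<open>d\<close> is over a nonempty set, so it is an actual
    positive weight and \<open>m = d - 1\<close> is not truncated.\<close>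
  have "\<exists>x :: 'a ^ ('n + 'n). x \<noteq> 0 \<and> d = swt x"
  proof -
    let ?S = "if sdual C \<noteq> C then sdual C - C else sdual C"
    have "?S - {0} \<noteq> {}" using CL Lnz vec.subspace_0[OF C] by (auto split: if_splits)
    then have "Min (swt ` (?S - {0})) \<in> swt ` (?S - {0})" by (intro Min_in) auto
    moreover have "d = Min (swt ` (?S - {0}))" using d by (simp add: min_swt_def)
    ultimately show ?thesis by blast
  qed
  then have dpos: "d > 0" using swt_pos by auto
  have dCm: "vec.dim C = 2 * m" using dpos mds dC unfolding m_def by linarith
  have wt: "m < swt x" if "x \<in> sdual C" "x \<noteq> 0" for x
  \<comment> \<open>For \<open>k = 0\<close> the code is self-dual and \<open>d\<close> is already
    the minimum over all nonzero elements of the dual. Otherwise \<open>d\<close> controls only the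
    vectors outside \<open>C\<close>.\<close>
  proof (cases "k = 0")
    case True
    then have "sdual C = C"
      using vec.subspace_dim_equal[OF C subspace_sdual CL] dL dC by simp
    then show ?thesis using that d min_swt_le[of x C] dpos by (simp add: m_def)
  next
    case False
    have out: "m < swt y" if "y \<in> sdual C - C" for y
    proof -
      have "y \<noteq> 0" using that vec.subspace_0[OF C] by auto
      moreover have "d = min_swt (sdual C - C)" using that d by auto
      ultimately have "d \<le> swt y" using that min_swt_le by metis
      then show ?thesis using dpos by (simp add: m_def)
    qed
    show ?thesis
    proof (cases "x \<in> C")
      case True
      have "2 * m < CARD('n)" using False dC dCm by simp
      then show ?thesis
        using no_low_weight_if_isotropic[OF C CL dCm _ out True] \<open>x \<noteq> 0\<close> by (meson not_le)
    qed (use that out in auto)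
  qed
  obtain E where E: "vec.subspace E" "E \<inter> sdual E = C" "vec.dim E = vec.dim C + 2 * r"
    using exists_extension_with_radical[OF C CL, of r] dC r by auto
  have EL: "E \<subseteq> sdual C"
    using E(2) subset_sdual_swap[of E C] by blast
  \<comment> \<open>As \<open>C\<close> is the radical of \<open>E\<close>, this is the set whose
    minimum weight is the distance of the code derived from \<open>E\<close>.\<close>
  define S where "S = (if sdual C \<noteq> E then sdual C - E else sdual C)"
  have dimL: "vec.dim (sdual C) + 2 * m = 2 * CARD('n)" using dL dCm by simp
  have "\<exists>x\<in>S. x \<noteq> 0 \<and> swt x = Suc m"
  proof (cases "sdual C = E")
    case True
    have "{0} \<subset> sdual C" using Lnz vec.subspace_0[OF subspace_sdual, of C] by auto
    then obtain x where "x \<in> sdual C - {0}" "swt x = Suc m"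
      using exists_minimum_weight[OF subspace_sdual dimL _ vec.subspace_single_0] wt by blast
    then show ?thesis using True by (auto simp: S_def)
  next
    case False
    then have "E \<subset> sdual C" using EL by blast
    then obtain x where x: "x \<in> sdual C - E" "swt x = Suc m"
      using exists_minimum_weight[OF subspace_sdual dimL _ E(1)] wt by blast
    then have "x \<noteq> 0" using vec.subspace_0[OF E(1)] by auto
    moreover have "x \<in> S" using False x(1) by (simp add: S_def)
    ultimately show ?thesis using x(2) by blast
  qed
  then obtain x where x: "x \<in> S" "x \<noteq> 0" "swt x = Suc m" by blast
  \<comment> \<open>\<open>S\<close> lies in \<open>sdual C\<close>, so \<open>wt\<close> gives the
    lower bound and \<open>x\<close> attains it.\<close>
  have "min_swt S = swt x"
    using x wt by (intro min_swt_eqI) (auto simp: S_def Suc_le_eq split: if_splits)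
  then have dS: "d = min_swt S" using x(3) dpos by (simp add: m_def)
  have "linear_subsystem_code E (k - r) r d"
    unfolding linear_subsystem_code_iff E(2) Let_def
    using E(1,3) dC r dS by (auto simp: S_def)
  then have "MDS_subsystem_code E (k - r) r d"
    using mds r by (simp add: MDS_subsystem_code_def)
  moreover have "pure_to E d"
    using wt EL dpos by (force simp: pure_to_def m_def)
  ultimately show "\<exists>C :: ('a ^ ('n + 'n)) set. MDS_subsystem_code C (k - r) r d \<and> pure_to C d"
    by blast
qed

end
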